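(* Let $b$ and $w$ be integers with $b>w\ge 1$. If a Pólya urn is started with $b$ black and $w$ white balls, then the probability that the number of black balls and the number of white balls will ever be equal, i.e. $P(\exists\, n\ge 0:\ B_n=W_n)$, equals $2F^{\mathrm{Beta}}_{b,w}(\tfrac12)$.
   Context: Pólya urn: the urn initially contains $B_0=b$ black and $W_0=w$ white balls. At each step a ball is drawn uniformly at random from the urn and is then replaced with two balls of the same color (so the net effect is to add one ball of the drawn color); this is repeated indefinitely. $B_n$ and $W_n$ denote the numbers of black and white balls after $n$ draws, so $B_n+W_n=b+w+n$, and conditionally on the first $n$ draws, draw $n+1$ is black with probability $B_n/(b+w+n)$ and white with probability $W_n/(b+w+n)$. $F^{\mathrm{Beta}}_{b,w}$ denotes the distribution function of the beta distribution with parameters $b,w$: $$F^{\mathrm{Beta}}_{b,w}(x)=\int_0^x \frac{\Gamma(b+w)}{\Gamma(b)\Gamma(w)}\,p^{b-1}(1-p)^{w-1}\,dp,\qquad 0\le x\le 1.$$ *)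

theory Defs
  imports "HOL-Probability.Probability"
begin

datatype colour = Black | White

text \<open>
  A sequence \<open>d\<close> of colours records an outcome of the draws; \<open>d n\<close> is the colour of draw number
  \<open>n + 1\<close>.  The two functions below give the content of the urn after the first \<open>n\<close> draws.
\<close>

primrec black_balls :: "nat \<Rightarrow> (nat \<Rightarrow> colour) \<Rightarrow> nat \<Rightarrow> nat" where
  "black_balls b d 0 = b"
| "black_balls b d (Suc n) = black_balls b d n + (if d n = Black then 1 else 0)"

primrec white_balls :: "nat \<Rightarrow> (nat \<Rightarrow> colour) \<Rightarrow> nat \<Rightarrow> nat" where
  "white_balls w d 0 = w"
| "white_balls w d (Suc n) = white_balls w d n + (if d n = White then 1 else 0)"

lemma black_white_total: "black_balls b d n + white_balls w d n = b + w + n"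
proof (induction n)
  case (Suc n)
  then show ?case by (cases "d n") auto
qed simp

text \<open>
  The history of the first \<open>n\<close> draws is a discrete random variable, so conditioning on it means
  conditioning on each event \<open>\<forall>i<n. D i \<omega> = d i\<close> of positive probability; only the first \<open>n\<close> values
  of \<open>d\<close> matter.
\<close>

locale polya_urn = prob_space M for M :: "'a measure" +
  fixes b w :: nat and D :: "nat \<Rightarrow> 'a \<Rightarrow> colour"
  assumes draw_measurable: "\<And>n. random_variable (count_space UNIV) (D n)"
    and draw_black: "\<And>n d. \<P>(\<omega> in M. \<forall>i<n. D i \<omega> = d i) > 0 \<Longrightarrow>
      \<P>(\<omega> in M. D n \<omega> = Black \<bar> \<forall>i<n. D i \<omega> = d i) = real (black_balls b d n) / real (b + w + n)"
    and draw_white: "\<And>n d. \<P>(\<omega> in M. \<forall>i<n. D i \<omega> = d i) > 0 \<Longrightarrow>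
      \<P>(\<omega> in M. D n \<omega> = White \<bar> \<forall>i<n. D i \<omega> = d i) = real (white_balls w d n) / real (b + w + n)"

text \<open>The formula is the distribution function for positive \<open>b\<close>, \<open>w\<close> and \<open>0 \<le> x \<le> 1\<close> only.\<close>

definition beta_cdf :: "nat \<Rightarrow> nat \<Rightarrow> real \<Rightarrow> real" where
  "beta_cdf b w x =
     (LBINT p:{0..x}. Gamma (real (b + w)) / (Gamma (real b) * Gamma (real w))
        * p ^ (b - 1) * (1 - p) ^ (w - 1))"

end

theory Submission
  imports Defs
begin

text \<open>
  Write \<open>F x y\<close> for the value at one half of the beta distribution function with parameters \<open>x\<close> and
  \<open>y\<close>, and let \<open>h x y = 2 * F x y\<close>.  Splitting the integrand \<open>p ^ (x - 1) * (1 - p) ^ (y - 1)\<close> by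
  \<open>1 = p + (1 - p)\<close> shows that \<open>h\<close> is harmonic for the urn chain on pairs (black, white), and the
  reflection \<open>p \<mapsto> 1 - p\<close> gives \<open>h x x = 1\<close> (\<open>half_beta_split\<close>, \<open>half_beta_diagonal\<close>).  So \<open>h\<close> solves
  the boundary value problem that the probability of a tie solves, and what remains is to single
  out the right solution: the expectation of \<open>h\<close> at time \<open>m\<close> on the event that no tie has
  occurred yet must tend to 0.

  Multiplied by the beta function of the starting state, that expectation is twice a sum, over
  tie-free draw sequences of length \<open>m\<close>, of integrals of \<open>p ^ (X - 1) * (1 - p) ^ (Y - 1)\<close> over
  \<open>p \<le> 1/2\<close>, where \<open>X \<ge> Y\<close> is the final state.  As \<open>p \<le> 1 - p\<close> and \<open>X \<ge> Y\<close>, each integrand is at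
  most \<open>sqrt (p * (1 - p)) ^ (X + Y - 2)\<close>, which depends on the total \<open>X + Y\<close> only
  (\<open>half_beta_le\<close>).  There are at most \<open>2 ^ m\<close> sequences and \<open>2 * sqrt (p * (1 - p)) < 1\<close> except at
  \<open>p = 1/2\<close>, so dominated convergence finishes the argument (\<open>geom_mean_integral_limit\<close>).

  The sum over sequences never appears: the bound is carried through the recursion of the
  probability of no tie within \<open>m\<close> draws (\<open>no_tie_prob_bounds\<close>).  The Markov property
  (\<open>prob_history_no_tie\<close>) identifies that recursion with the random process.
\<close>

section \<open>The urn seen as a Markov chain\<close>

text \<open>
  The first-step recursion for the probability that an urn with \<open>x\<close> black and \<open>y\<close> white balls shows
  no tie at any of the times \<open>0, \<dots>, m\<close>.
\<close>

primrec no_tie_prob :: "nat \<Rightarrow> nat \<Rightarrow> nat \<Rightarrow> real" where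
  "no_tie_prob 0 x y = (if x = y then 0 else 1)"
| "no_tie_prob (Suc m) x y = (if x = y then 0 else
     real x / real (x + y) * no_tie_prob m (Suc x) y + real y / real (x + y) * no_tie_prob m x (Suc y))"

lemma black_balls_cong: "(\<And>i. i < n \<Longrightarrow> d i = d' i) \<Longrightarrow> black_balls b d n = black_balls b d' n"
  by (induction n) auto

lemma white_balls_cong: "(\<And>i. i < n \<Longrightarrow> d i = d' i) \<Longrightarrow> white_balls w d n = white_balls w d' n"
  by (induction n) auto

context polya_urn
begin

lemma pred_draw [measurable]: "Measurable.pred M (\<lambda>\<omega>. D n \<omega> = c)"
  by (rule pred_count_space_const1[OF draw_measurable])

lemma pred_black_balls: "Measurable.pred M (\<lambda>\<omega>. black_balls b (\<lambda>i. D i \<omega>) n = x)"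
proof (induction n arbitrary: x)
  case (Suc n)
  have "black_balls b (\<lambda>i. D i \<omega>) (Suc n) = x \<longleftrightarrow>
      (D n \<omega> = Black \<and> (0 < x \<and> black_balls b (\<lambda>i. D i \<omega>) n = x - 1)) \<or>
      (\<not> D n \<omega> = Black \<and> black_balls b (\<lambda>i. D i \<omega>) n = x)" for \<omega>
    by auto
  then show ?case
    by (simp only:) (intro pred_intros_logic(2,3,5) pred_intros_conj1' pred_draw Suc)
qed simp

lemma pred_white_balls: "Measurable.pred M (\<lambda>\<omega>. white_balls w (\<lambda>i. D i \<omega>) n = x)"
proof (induction n arbitrary: x)
  case (Suc n)
  have "white_balls w (\<lambda>i. D i \<omega>) (Suc n) = x \<longleftrightarrow>
      (D n \<omega> = White \<and> (0 < x \<and> white_balls w (\<lambda>i. D i \<omega>) n = x - 1)) \<or>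
      (\<not> D n \<omega> = White \<and> white_balls w (\<lambda>i. D i \<omega>) n = x)" for \<omega>
    by auto
  then show ?case
    by (simp only:) (intro pred_intros_logic(2,3,5) pred_intros_conj1' pred_draw Suc)
qed simp

lemma pred_history [measurable]: "Measurable.pred M (\<lambda>\<omega>. \<forall>i<n. D i \<omega> = d i)"
  by (intro pred_intros_countable pred_intros_imp' pred_draw)

text \<open>
  The numbers of balls are natural numbers, so a tie is a countable union over its possible common
  values.
\<close>

lemma pred_no_tie:
  "Measurable.pred M
    (\<lambda>\<omega>. \<forall>k\<le>m. black_balls b (\<lambda>i. D i \<omega>) (n + k) \<noteq> white_balls w (\<lambda>i. D i \<omega>) (n + k))"
proof -
  have "black_balls b (\<lambda>i. D i \<omega>) j \<noteq> white_balls w (\<lambda>i. D i \<omega>) j \<longleftrightarrow>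
      \<not> (\<exists>x. black_balls b (\<lambda>i. D i \<omega>) j = x \<and> white_balls w (\<lambda>i. D i \<omega>) j = x)" for j \<omega>
    by metis
  then show ?thesis
    by (simp only:) (intro pred_intros_countable pred_intros_imp' pred_intros_logic(2,3)
        pred_black_balls pred_white_balls)
qed

text \<open>
  The multiplication rule turns the conditional probabilities of the urn into unconditional ones.
  A history of probability 0 has no conditional law, but then both sides vanish, so no
  positivity condition is left for the induction below.
\<close>

lemma prob_next_draw:
  "\<P>(\<omega> in M. \<forall>i<Suc n. D i \<omega> = (d(n := c)) i) =
     \<P>(\<omega> in M. \<forall>i<n. D i \<omega> = d i)
       * (real (case c of Black \<Rightarrow> black_balls b d n | White \<Rightarrow> white_balls w d n) / real (b + w + n))"
proof -
  let ?E = "\<lambda>\<omega>. \<forall>i<n. D i \<omega> = d i"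
  have eq: "(\<forall>i<Suc n. D i \<omega> = (d(n := c)) i) \<longleftrightarrow> D n \<omega> = c \<and> ?E \<omega>" for \<omega>
    by (auto simp: less_Suc_eq)
  have cond: "\<P>(\<omega> in M. D n \<omega> = c \<and> ?E \<omega>) = \<P>(\<omega> in M. D n \<omega> = c \<bar> ?E \<omega>) * \<P>(\<omega> in M. ?E \<omega>)"
    if "\<P>(\<omega> in M. ?E \<omega>) > 0"
    using that by (simp add: cond_prob_def)
  show ?thesis
  proof (cases "\<P>(\<omega> in M. ?E \<omega>) > 0")
    case True
    then show ?thesis
      unfolding eq cond[OF True] using draw_black[OF True] draw_white[OF True]
      by (cases c) simp_all
  next
    case False
    then have 0: "\<P>(\<omega> in M. ?E \<omega>) = 0"
      by (simp add: zero_less_measure_iff)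
    have "\<P>(\<omega> in M. D n \<omega> = c \<and> ?E \<omega>) \<le> \<P>(\<omega> in M. ?E \<omega>)"
      by (intro finite_measure_mono) auto
    then show ?thesis
      unfolding eq 0 by (simp add: measure_le_0_iff)
  qed
qed

text \<open>
  The Markov property.  The number \<open>m\<close> of future draws is the induction variable while the history
  varies, so the induction step conditions on the first of the future draws, as the
  recursion of \<^const>\<open>no_tie_prob\<close> does.
\<close>

lemma prob_history_no_tie:
  "\<P>(\<omega> in M. (\<forall>i<n. D i \<omega> = d i) \<and>
        (\<forall>k\<le>m. black_balls b (\<lambda>i. D i \<omega>) (n + k) \<noteq> white_balls w (\<lambda>i. D i \<omega>) (n + k))) =
     \<P>(\<omega> in M. \<forall>i<n. D i \<omega> = d i) * no_tie_prob m (black_balls b d n) (white_balls w d n)"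
proof (induction m arbitrary: n d)
  case 0
  have eq: "(\<forall>i<n. D i \<omega> = d i) \<and>
      (\<forall>k\<le>0. black_balls b (\<lambda>i. D i \<omega>) (n + k) \<noteq> white_balls w (\<lambda>i. D i \<omega>) (n + k)) \<longleftrightarrow>
      (\<forall>i<n. D i \<omega> = d i) \<and> black_balls b d n \<noteq> white_balls w d n" for \<omega>
    using black_balls_cong[of n "\<lambda>i. D i \<omega>" d b] white_balls_cong[of n "\<lambda>i. D i \<omega>" d w] by auto
  show ?case
    unfolding eq by (cases "black_balls b d n = white_balls w d n") simp_all
next
  case (Suc m)
  let ?E = "\<lambda>n d \<omega>. \<forall>i<n. D i \<omega> = d i"
  let ?ne = "\<lambda>n \<omega>. black_balls b (\<lambda>i. D i \<omega>) n \<noteq> white_balls w (\<lambda>i. D i \<omega>) n"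
  let ?S = "\<lambda>c. {\<omega> \<in> space M. ?E (Suc n) (d(n := c)) \<omega> \<and> (\<forall>k\<le>m. ?ne (Suc n + k) \<omega>)}"
  have all_Suc: "(\<forall>k\<le>Suc m. ?ne (n + k) \<omega>) \<longleftrightarrow> ?ne n \<omega> \<and> (\<forall>k\<le>m. ?ne (Suc n + k) \<omega>)" for \<omega>
    by (simp only: flip: less_Suc_eq_le) (simp only: All_less_Suc2 add_0_right add_Suc_shift)
  have state: "?ne n \<omega> \<longleftrightarrow> black_balls b d n \<noteq> white_balls w d n" if "?E n d \<omega>" for \<omega>
    using that black_balls_cong[of n "\<lambda>i. D i \<omega>" d b] white_balls_cong[of n "\<lambda>i. D i \<omega>" d w] by auto
  show ?case
  proof (cases "black_balls b d n = white_balls w d n")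
    case True
    have "{\<omega> \<in> space M. ?E n d \<omega> \<and> (\<forall>k\<le>Suc m. ?ne (n + k) \<omega>)} = {}"
      using state True unfolding all_Suc by blast
    then show ?thesis using True by (simp only: measure_empty) simp
  next
    case False
    have split: "{\<omega> \<in> space M. ?E n d \<omega> \<and> (\<forall>k\<le>Suc m. ?ne (n + k) \<omega>)} = ?S Black \<union> ?S White"
    proof -
      have draw: "?E n d \<omega> \<longleftrightarrow> ?E (Suc n) (d(n := Black)) \<omega> \<or> ?E (Suc n) (d(n := White)) \<omega>" for \<omega>
        by (cases "D n \<omega>") (auto simp: less_Suc_eq)
      have no_tie: "?E n d \<omega> \<and> ?ne n \<omega> \<longleftrightarrow> ?E n d \<omega>" for \<omega>
        using state[of \<omega>] False by argo
      have "?E n d \<omega> \<and> (\<forall>k\<le>Suc m. ?ne (n + k) \<omega>) \<longleftrightarrow>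
          (?E (Suc n) (d(n := Black)) \<omega> \<and> (\<forall>k\<le>m. ?ne (Suc n + k) \<omega>)) \<or>
          (?E (Suc n) (d(n := White)) \<omega> \<and> (\<forall>k\<le>m. ?ne (Suc n + k) \<omega>))" for \<omega>
        using draw[of \<omega>] no_tie[of \<omega>] all_Suc[of \<omega>] by argo
      then show ?thesis
        by (simp only: conj_disj_distribL Collect_disj_eq)
    qed
    have disj: "?S Black \<inter> ?S White = {}"
    proof (intro equals0I)
      fix \<omega> assume "\<omega> \<in> ?S Black \<inter> ?S White"
      then have "D n \<omega> = (d(n := Black)) n" "D n \<omega> = (d(n := White)) n"
        by (blast intro: lessI)+
      then show False by simp
    qed
    have S: "?S c \<in> sets M" for c
      by (intro sets.sets_Collect_conj predE pred_history pred_no_tie)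
    have same: "black_balls b (d(n := c)) n = black_balls b d n"
      "white_balls w (d(n := c)) n = white_balls w d n" for c
      by (auto intro!: black_balls_cong white_balls_cong)
    have next_state: "black_balls b (d(n := c)) (Suc n) = black_balls b d n + (if c = Black then 1 else 0)"
      "white_balls w (d(n := c)) (Suc n) = white_balls w d n + (if c = White then 1 else 0)" for c
      by (simp_all only: same black_balls.simps white_balls.simps fun_upd_same)
    define p where "p = \<P>(\<omega> in M. ?E n d \<omega>)"
    have "measure M (?S Black \<union> ?S White) = measure M (?S Black) + measure M (?S White)"
      by (rule finite_measure_Union[OF S S disj])
    also have "\<dots> = p * no_tie_prob (Suc m) (black_balls b d n) (white_balls w d n)"
      unfolding Suc.IH prob_next_draw next_state p_def[symmetric] black_white_total[symmetric, of b w n d]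
      using False by (simp add: algebra_simps)
    finally show ?thesis
      unfolding split p_def .
  qed
qed

lemma prob_no_tie_upto:
  "\<P>(\<omega> in M. \<forall>k\<le>m. black_balls b (\<lambda>i. D i \<omega>) k \<noteq> white_balls w (\<lambda>i. D i \<omega>) k) = no_tie_prob m b w"
  using prob_history_no_tie[of 0 undefined m]
  by (simp only: not_less_zero simp_thms add_0 black_balls.simps white_balls.simps Collect_mem_eq
      prob_space mult_1)

lemma prob_ever_equal:
  assumes lim: "(\<lambda>m. no_tie_prob m b w) \<longlonglongrightarrow> a"
  shows "\<P>(\<omega> in M. \<exists>n. black_balls b (\<lambda>i. D i \<omega>) n = white_balls w (\<lambda>i. D i \<omega>) n) = 1 - a"
proof -
  let ?A = "\<lambda>m. {\<omega> \<in> space M. \<forall>k\<le>m. black_balls b (\<lambda>i. D i \<omega>) k \<noteq> white_balls w (\<lambda>i. D i \<omega>) k}"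
  have A: "?A m \<in> sets M" for m
    using predE[OF pred_no_tie[of m 0]] by (simp only: add_0)
  then have range: "range ?A \<subseteq> sets M" by blast
  then have "(\<lambda>m. measure M (?A m)) \<longlonglongrightarrow> measure M (\<Inter>m. ?A m)"
    by (rule finite_Lim_measure_decseq) (auto simp: decseq_def)
  then have a: "measure M (\<Inter>m. ?A m) = a"
    unfolding prob_no_tie_upto using lim LIMSEQ_unique by blast
  have "{\<omega> \<in> space M. \<exists>n. black_balls b (\<lambda>i. D i \<omega>) n = white_balls w (\<lambda>i. D i \<omega>) n}
      = space M - (\<Inter>m. ?A m)"
    by blast
  then show ?thesis
    using prob_compl[OF sets.countable_INT[OF range UNIV_not_empty]] a by (simp only:)
qed

end

section \<open>The incomplete beta integral at one half\<close>

text \<open>The incomplete beta function at one half, without the normalising factor.\<close>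

definition half_beta :: "nat \<Rightarrow> nat \<Rightarrow> real" where
  "half_beta x y = integral {0..1/2} (\<lambda>p::real. p ^ (x - 1) * (1 - p) ^ (y - 1))"

lemma beta_kernel_integrable [simp]:
  "(\<lambda>p::real. p ^ i * (1 - p) ^ j) integrable_on {a..c}"
  by (intro integrable_continuous_real continuous_intros)

text \<open>
  The integrand splits by \<open>p + (1 - p) = 1\<close>.  The complete beta function satisfies the same
  identity with \<open>x / (x + y)\<close> and \<open>y / (x + y)\<close> as the shares of the two summands, which is why the
  quotient is harmonic.
\<close>

lemma half_beta_split:
  assumes "x \<ge> 1" "y \<ge> 1"
  shows "half_beta x y = half_beta (Suc x) y + half_beta x (Suc y)"
proof -
  obtain i j where "x = Suc i" "y = Suc j"
    using assms by (metis Suc_le_D One_nat_def)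
  then show ?thesis
    unfolding half_beta_def integral_add[OF beta_kernel_integrable beta_kernel_integrable, symmetric]
    by (intro integral_cong) (simp add: algebra_simps)
qed

lemma integral_beta_kernel:
  assumes "x \<ge> 1" "y \<ge> 1"
  shows "((\<lambda>p::real. p ^ (x - 1) * (1 - p) ^ (y - 1)) has_integral Beta (real x) (real y)) {0..1}"
  \<comment> \<open>The two integrands differ at the end points when an exponent is 0: \<open>0 ^ 0 = 1\<close>, but \<open>0 powr 0 = 0\<close>.\<close>
proof (rule has_integral_spike_finite[where S = "{0, 1}"])
  show "((\<lambda>t. t powr (real x - 1) * (1 - t) powr (real y - 1)) has_integral Beta (real x) (real y)) {0..1}"
    using assms by (intro has_integral_Beta_real) auto
  show "t ^ (x - 1) * (1 - t) ^ (y - 1) = t powr (real x - 1) * (1 - t) powr (real y - 1)"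
    if "t \<in> {0..1} - {0, 1}" for t :: real
    using that assms powr_realpow[of t "x - 1"] powr_realpow[of "1 - t" "y - 1"]
    by (auto simp: of_nat_diff)
qed auto

text \<open>For equal parameters the integrand is symmetric about one half.\<close>

lemma half_beta_diagonal:
  assumes "x \<ge> 1"
  shows "2 * half_beta x x = Beta (real x) (real x)"
proof -
  let ?f = "\<lambda>p::real. p ^ (x - 1) * (1 - p) ^ (x - 1)"
  have left: "(?f has_integral half_beta x x) (cbox 0 (1/2))"
    unfolding half_beta_def cbox_interval by (rule integrable_integral[OF beta_kernel_integrable])
  from has_integral_affinity[OF left, of "-1" 1]
  have right: "(?f has_integral half_beta x x) {1/2..1}"
    by (simp add: image_affinity_atLeastAtMost_diff mult.commute image_iff scaleR_conv_of_real)
  have "(?f has_integral (half_beta x x + half_beta x x)) {0..1}"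
    by (rule has_integral_combine[OF _ _ left[unfolded cbox_interval] right]) simp_all
  then show ?thesis
    using has_integral_unique[OF integral_beta_kernel[OF assms assms]] by simp
qed

lemma beta_cdf_half:
  "beta_cdf x y (1 / 2) = half_beta x y / Beta (real x) (real y)"
proof -
  let ?c = "Gamma (real (x + y)) / (Gamma (real x) * Gamma (real y))"
  have "set_integrable lborel {0..1/2} (\<lambda>p::real. ?c * p ^ (x - 1) * (1 - p) ^ (y - 1))"
    by (intro borel_integrable_atLeastAtMost' continuous_intros)
  then have "beta_cdf x y (1 / 2) = integral {0..1/2} (\<lambda>p. ?c * (p ^ (x - 1) * (1 - p) ^ (y - 1)))"
    unfolding beta_cdf_def by (subst set_borel_integral_eq_integral) (simp_all add: mult.assoc)
  then show ?thesis
    unfolding half_beta_def Beta_def by simp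
qed

section \<open>The probability of no tie in the limit\<close>

definition geom_mean_integral :: "nat \<Rightarrow> real" where
  "geom_mean_integral n = integral {0..1/2} (\<lambda>p::real. sqrt (p * (1 - p)) ^ n)"

text \<open>
  With \<open>p \<le> sqrt (p * (1 - p))\<close> for \<open>p \<le> 1/2\<close>, the surplus of \<open>x - y\<close> factors \<open>p\<close> is replaced by geometric
  means.  The bound depends on the total \<open>x + y\<close> only, which is the same for all states that the
  urn can reach in a given number of draws.
\<close>

lemma half_beta_le:
  assumes "x \<ge> y" "y \<ge> 1"
  shows "half_beta x y \<le> geom_mean_integral (x + y - 2)"
  unfolding half_beta_def geom_mean_integral_def
proof (rule integral_le)
  show "(\<lambda>p::real. sqrt (p * (1 - p)) ^ (x + y - 2)) integrable_on {0..1/2}"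
    by (intro integrable_continuous_real continuous_intros)
  fix p :: real assume p: "p \<in> {0..1/2}"
  obtain j k where xy: "y = Suc j" "x = Suc (j + k)"
    using assms by (metis Suc_le_D One_nat_def add_Suc le_add_diff_inverse)
  have "p = sqrt (p * p)" using p by simp
  also have "\<dots> \<le> sqrt (p * (1 - p))" using p by (intro real_sqrt_le_mono mult_left_mono) auto
  finally have "p ^ k \<le> sqrt (p * (1 - p)) ^ k" using p by (intro power_mono) auto
  then have "(p * (1 - p)) ^ j * p ^ k \<le> (p * (1 - p)) ^ j * sqrt (p * (1 - p)) ^ k"
    using p by (intro mult_left_mono) auto
  also have "\<dots> = sqrt (p * (1 - p)) ^ (2 * j + k)"
    using p by (simp add: power_add power_mult)
  also have "2 * j + k = x + y - 2" by (simp add: xy)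
  finally show "p ^ (x - 1) * (1 - p) ^ (y - 1) \<le> sqrt (p * (1 - p)) ^ (x + y - 2)"
    by (simp add: xy power_add power_mult_distrib mult_ac)
qed simp

lemma half_beta_nonneg: "half_beta x y \<ge> 0"
  unfolding half_beta_def by (intro integral_nonneg) auto

lemma Beta_nat_pos: "x \<ge> 1 \<Longrightarrow> y \<ge> 1 \<Longrightarrow> Beta (real x) (real y) > 0"
  unfolding Beta_def by (intro divide_pos_pos mult_pos_pos Gamma_real_pos) auto

text \<open>
  After multiplication by the beta function the recursion of \<^const>\<open>no_tie_prob\<close> loses its weights
  and becomes a plain sum over the two successor states.  The first two terms of the bounds satisfy the same
  recursion and vanish on the diagonal; the error term doubles with each draw because the error
  bounds of the two successors agree.
\<close>

lemma no_tie_prob_bounds: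
  assumes "x \<ge> y" "y \<ge> 1"
  shows "Beta (real x) (real y) - 2 * half_beta x y \<le> Beta (real x) (real y) * no_tie_prob m x y
    \<and> Beta (real x) (real y) * no_tie_prob m x y
      \<le> Beta (real x) (real y) - 2 * half_beta x y + 2 * (2 ^ m * geom_mean_integral (x + y - 2 + m))"
  using assms
proof (induction m arbitrary: x y)
  case 0
  show ?case
    using half_beta_le[OF "0.prems"] half_beta_nonneg[of x y] half_beta_diagonal[of x] "0.prems" 
    by auto
next
  case (Suc m)
  show ?case
  proof (cases "x = y")
    case True
    have "geom_mean_integral n \<ge> 0" for n
      unfolding geom_mean_integral_def
      by (intro integral_nonneg integrable_continuous_real continuous_intros) auto
    then show ?thesis using True half_beta_diagonal[of x] Suc.prems by simp
  next
    case False
    let ?B = "\<lambda>x y. Beta (real x) (real y)"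
    have pos: "real x > 0" "real y > 0" using Suc.prems by auto
    have L: "real x / real (x + y) * ?B x y = ?B (Suc x) y"
      using Beta_plus1_left[of "real x" "real y"] pos by (auto simp: field_simps nonpos_Ints_def)
    have R: "real y / real (x + y) * ?B x y = ?B x (Suc y)"
      using Beta_plus1_right[of "real y" "real x"] pos by (auto simp: field_simps nonpos_Ints_def)
    have sum: "?B x y = ?B (Suc x) y + ?B x (Suc y)"
      unfolding L[symmetric] R[symmetric] distrib_right[symmetric] add_divide_distrib[symmetric]
      using pos by simp
    have step: "?B x y * no_tie_prob (Suc m) x y = ?B (Suc x) y * no_tie_prob m (Suc x) y + ?B x (Suc y) * no_tie_prob m x (Suc y)"
      unfolding L[symmetric] R[symmetric] using False by (simp add: algebra_simps)
    have idx: "Suc x + y - 2 + m = x + y - 2 + Suc m" "x + Suc y - 2 + m = x + y - 2 + Suc m"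
      using Suc.prems by auto
    show ?thesis
      using Suc.IH[of y "Suc x"] Suc.IH[of "Suc y" x] half_beta_split[of x y] Suc.prems False
      unfolding step idx using sum by auto
  qed
qed

text \<open>
  The integrand contains the factor \<open>(2 * sqrt (p * (1 - p))) ^ m\<close>, whose base is at most 1 by the inequality of
  arithmetic and geometric means, with equality at \<open>p = 1/2\<close> only.
\<close>

lemma geom_mean_integral_limit:
  "(\<lambda>m. 2 ^ m * geom_mean_integral (n + m)) \<longlonglongrightarrow> 0"
proof -
  let ?f = "\<lambda>m p::real. 2 ^ m * sqrt (p * (1 - p)) ^ (n + m)"
  let ?g = "\<lambda>p::real. if p = 1/2 then (1/2) ^ n else 0 :: real"
  have bound: "2 * sqrt (p * (1 - p)) \<le> 1" for p :: real
  proof -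
    have "p * (1 - p) \<le> (1/2)\<^sup>2" using zero_le_power2[of "p - 1/2"] by (simp add: power2_eq_square algebra_simps)
    then have "sqrt (p * (1 - p)) \<le> 1/2" by (intro real_le_lsqrt) auto
    then show ?thesis by simp
  qed
  have "(\<lambda>m. integral {0..1/2} (?f m)) \<longlonglongrightarrow> integral {0..1/2} ?g"
  proof (rule dominated_convergence(2)[where h = "\<lambda>_. 1"])
    show "?f m integrable_on {0..1/2}" for m
      by (intro integrable_continuous_real continuous_intros)
    fix p :: real assume p: "p \<in> {0..1/2}"
    define s where "s = sqrt (p * (1 - p))"
    have s: "0 \<le> s" "2 * s \<le> 1" unfolding s_def using p bound by auto
    have eq: "?f m p = s ^ n * (2 * s) ^ m" for m
      by (simp add: s_def power_add power_mult_distrib mult_ac)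
    show "norm (?f m p) \<le> 1" for m
    proof -
      have "s ^ n * (2 * s) ^ m \<le> 1"
        using s by (intro mult_le_one[OF power_le_one _ power_le_one]) auto
      then show ?thesis unfolding eq using s by simp
    qed
    show "(\<lambda>m. ?f m p) \<longlonglongrightarrow> ?g p"
    proof (cases "p = 1/2")
      case True
      then have "p * (1 - p) = (1/2)\<^sup>2" by (simp only: power2_eq_square) simp
      then have "s = 1/2" unfolding s_def by (simp only: real_sqrt_abs)
      then show ?thesis unfolding eq by (simp only: True) simp
    next
      case False
      then have "0 < (p - 1/2)\<^sup>2" by simp
      then have "p * (1 - p) < (1/2)\<^sup>2" by (simp add: power2_eq_square algebra_simps)
      then have "s < 1/2" unfolding s_def by (intro real_less_lsqrt) simp_all
      then have "2 * s < 1" by simp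
      then have "(\<lambda>m. s ^ n * (2 * s) ^ m) \<longlonglongrightarrow> s ^ n * 0"
        using s by (intro tendsto_mult tendsto_const LIMSEQ_realpow_zero) auto
      then show ?thesis unfolding eq using False by simp
    qed
  qed auto
  moreover have "integral {0..1/2} ?g = 0"
    by (intro integral_unique has_integral_spike_finite[OF _ _ has_integral_0, where S = "{1/2}"]) auto
  ultimately show ?thesis unfolding geom_mean_integral_def by simp
qed

lemma no_tie_prob_limit:
  assumes "x \<ge> y" "y \<ge> 1"
  shows "(\<lambda>m. no_tie_prob m x y) \<longlonglongrightarrow> 1 - 2 * beta_cdf x y (1 / 2)"
proof -
  let ?B = "Beta (real x) (real y)"
  have B: "?B > 0" using assms by (intro Beta_nat_pos) auto
  have upper: "(\<lambda>m. ?B - 2 * half_beta x y + 2 * (2 ^ m * geom_mean_integral (x + y - 2 + m)))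
      \<longlonglongrightarrow> ?B - 2 * half_beta x y + 2 * 0"
    by (intro tendsto_intros geom_mean_integral_limit)
  have "(\<lambda>m. ?B * no_tie_prob m x y) \<longlonglongrightarrow> ?B - 2 * half_beta x y"
  proof (rule tendsto_sandwich[OF always_eventually always_eventually tendsto_const])
    show "(\<lambda>m. ?B - 2 * half_beta x y + 2 * (2 ^ m * geom_mean_integral (x + y - 2 + m)))
        \<longlonglongrightarrow> ?B - 2 * half_beta x y"
      using upper by simp
  qed (use no_tie_prob_bounds[OF assms] in blast)+
  then have "(\<lambda>m. ?B * no_tie_prob m x y / ?B) \<longlonglongrightarrow> (?B - 2 * half_beta x y) / ?B"
    using B by (intro tendsto_divide) auto
  then show ?thesis
    using B by (simp add: beta_cdf_half diff_divide_distrib)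
qed

theorem mainTheorem1:
  fixes M :: "'a measure" and b w :: nat and D :: "nat \<Rightarrow> 'a \<Rightarrow> colour"
  assumes "polya_urn M b w D"
    and "b > w" and "w \<ge> 1"
  shows "\<P>(\<omega> in M. \<exists>n. black_balls b (\<lambda>i. D i \<omega>) n = white_balls w (\<lambda>i. D i \<omega>) n)
           = 2 * beta_cdf b w (1 / 2)"
  using polya_urn.prob_ever_equal[OF assms(1) no_tie_prob_limit] assms(2,3) by simp

end
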